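(* There are at most $2^{O(kn\log^2 n)}$ labelled $n$-vertex intersection graphs of $x$-monotone pseudo-segments in the plane with clique number at most $k$. Moreover, for $k<n^{1/3}$, this bound is tight up to a polylogarithmic factor in the exponent.
   Context: Here $k$ and $n$ are positive integers, and the constant implicit in $O(\cdot)$ is absolute. "Tight up to a polylogarithmic factor in the exponent" means that the number of such graphs is also bounded from below by $2$ raised to a power that is smaller than $kn\log^2 n$ by at most a factor polylogarithmic in $n$. A curve is a subset of the plane $\mathbb{R}^2$ homeomorphic to the interval $[0,1]$. A curve is $x$-monotone if every vertical line intersects it in at most one point. A collection of curves is a collection of pseudo-segments if every pair of them have at most one point in common. A labelled $n$-vertex intersection graph of curves of a given kind is a graph $G$ on the vertex set $\{1,\dots,n\}$ for which there is a collection $\gamma_1,\dots,\gamma_n$ of curves of that kind such that distinct $i,j$ are adjacent in $G$ if and only if $\gamma_i\cap\gamma_j\neq\emptyset$. Labelled graphs are counted as distinct if their edge sets differ.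
   Formalization: The tightness claim is stated for 2 ≤ k < n^{1/3} rather than all positive k < n^{1/3}: for k = 1 the only graph is the edgeless one, so the count is 1 = 2^0 and no positive exponent is possible. *)

theory Defs
  imports "HOL-Analysis.Analysis" "HOL-Library.Ramsey"
begin

definition is_curve :: "(real \<times> real) set \<Rightarrow> bool" where
  "is_curve S \<longleftrightarrow> S homeomorphic {0..1::real}"

definition vertical_line :: "real \<Rightarrow> (real \<times> real) set" where
  "vertical_line a = {p. fst p = a}"

definition x_monotone :: "(real \<times> real) set \<Rightarrow> bool" where
  "x_monotone S \<longleftrightarrow> (\<forall>a. \<exists>\<^sub>\<le>\<^sub>1 p. p \<in> S \<inter> vertical_line a)"

text \<open>Collections are indexed families, as in the definition of a labelled intersection graph.
  Curves with different indices count as a pair, so they cannot be equal as sets.\<close>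

definition pseudo_segments :: "'i set \<Rightarrow> ('i \<Rightarrow> (real \<times> real) set) \<Rightarrow> bool" where
  "pseudo_segments I \<gamma> \<longleftrightarrow>
     (\<forall>i\<in>I. is_curve (\<gamma> i)) \<and>
     (\<forall>i\<in>I. \<forall>j\<in>I. i \<noteq> j \<longrightarrow> (\<exists>\<^sub>\<le>\<^sub>1 p. p \<in> \<gamma> i \<inter> \<gamma> j))"

text \<open>A simple graph on a given vertex set is identified with its set of edges, each edge being
  the two-element set of its endpoints.\<close>

definition intersection_edges :: "'i set \<Rightarrow> ('i \<Rightarrow> (real \<times> real) set) \<Rightarrow> 'i set set" where
  "intersection_edges I \<gamma> = {{i, j} | i j. i \<in> I \<and> j \<in> I \<and> i \<noteq> j \<and> \<gamma> i \<inter> \<gamma> j \<noteq> {}}"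

definition clique_number :: "'i set \<Rightarrow> 'i set set \<Rightarrow> nat" where
  "clique_number V E = Max (card ` {K. K \<subseteq> V \<and> clique K E})"

definition xmono_pseudo_segment_graphs :: "nat \<Rightarrow> nat set set set" where
  "xmono_pseudo_segment_graphs n =
     {E. \<exists>\<gamma>. pseudo_segments {1..n} \<gamma> \<and> (\<forall>i\<in>{1..n}. x_monotone (\<gamma> i)) \<and>
          E = intersection_edges {1..n} \<gamma>}"

definition num_graphs :: "nat \<Rightarrow> nat \<Rightarrow> nat" where
  "num_graphs n k = card {E \<in> xmono_pseudo_segment_graphs n. clique_number {1..n} E \<le> k}"

text \<open>The set counted above is finite, so its cardinality is not the default value 0.\<close>

lemma finite_xmono_pseudo_segment_graphs: "finite (xmono_pseudo_segment_graphs n)"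
proof (rule finite_subset)
  show "xmono_pseudo_segment_graphs n \<subseteq> Pow (Pow {1..n})"
    by (auto simp: xmono_pseudo_segment_graphs_def intersection_edges_def)
qed simp

end

theory Submission
  imports Defs
begin

text \<open>
  Upper bound. An \<open>x\<close>-monotone curve is the graph of a continuous function over a compact interval.
  Fix an interval \<open>J\<close> of abscissae and consider the curves that have an endpoint over \<open>J\<close>; let \<open>p\<close> be
  the number of these endpoints. Cut \<open>J\<close> at a median endpoint \<open>c\<close> into a left part, the single
  point \<open>c\<close> and a right part. When two of the curves meet over a part, either both have an endpoint
  over that part, which is a recursive problem with at most \<open>p / 2\<close> endpoints, or one of them spans
  the part (\<open>inner_edges_split\<close>). Two curves that span a part and do not meet there lie one strictly
  above the other, so \<^emph>\<open>strictly below\<close> is a partial order on the spanning curves whose antichains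
  are cliques. By Dilworth's theorem, \<open>k\<close> chains cover it. By the intermediate value theorem, a
  curve meets a contiguous block of each chain (\<open>hits_are_rank_interval\<close>), so two
  ranks for each of the \<open>k\<close> chains tell which spanning curves it meets. With at most \<open>p\<close> curves
  involved, a part costs \<open>O(k p log n)\<close> bits (\<open>card_codes_le\<close>). The recursion starts with \<open>2 n\<close>
  endpoints, has \<open>O(log n)\<close> levels, and each level costs \<open>O(k n log n)\<close> bits in total.

  Lower bound. Take the lines \<open>y = m x + c\<close> with \<open>k - 1\<close> slopes \<open>m\<close> and about \<open>n / (4 k)\<close> integer
  intercepts \<open>c\<close>, together with integer points on them at about \<open>k / 2\<close> abscissae; the condition
  \<open>k\<^sup>3 < n\<close> leaves room for all these points among \<open>n\<close> vertices. There are of the order of \<open>k n\<close>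
  incidences. Replace every point by a short horizontal segment. An incidence is destroyed
  by lifting the line a little near the point, and this can be done independently for all
  incidences. The liftings are so flat that lines of different slopes still cross at most once and
  parallel ones never. A clique has at most one line of each slope and at most one point, hence at
  most \<open>k\<close> vertices. So every set of incidences yields its own graph (\<open>num_graphs_lower\<close>), which
  gives \<open>2\<close> to the power \<open>k n / 48\<close> graphs.
\<close>

section \<open>Dilworth's theorem\<close>

text \<open>Galvin's argument. Remove a maximal element \<open>a\<close> and colour the rest with as many colours as its
  largest antichains have elements. In each colour class, let \<open>t i\<close> be the largest element that
  lies in some largest antichain. The \<open>t i\<close> form an antichain. Either \<open>a\<close> is incomparable to all of
  them, and then it extends this antichain and may receive a new colour; or \<open>a\<close> is above
  some \<open>t i\<close>, and then removing the chain that consists of \<open>a\<close>, \<open>t i\<close> and the elements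
  of colour \<open>i\<close> below \<open>t i\<close> destroys all largest antichains.\<close>

lemma dilworth:
  fixes r :: "'a \<Rightarrow> 'a \<Rightarrow> bool"
  assumes "finite P" and tr: "transp r" and ir: "irreflp r"
    and "\<And>A. A \<subseteq> P \<Longrightarrow> \<forall>x\<in>A. \<forall>y\<in>A. \<not> r x y \<Longrightarrow> card A \<le> w"
  shows "\<exists>h :: 'a \<Rightarrow> nat. (\<forall>x\<in>P. h x < w) \<and>
           (\<forall>x\<in>P. \<forall>y\<in>P. h x = h y \<longrightarrow> x = y \<or> r x y \<or> r y x)"
  using assms(1,4)
proof (induction P arbitrary: w rule: finite_psubset_induct)
  case (psubset P)
  define anti where "anti = (\<lambda>A. \<forall>x\<in>A. \<forall>y\<in>A. \<not> r x y)"
  have tr': "r x z" if "r x y" "r y z" for x y z using tr that by (meson transpE)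
  have ir': "\<not> r x x" for x using ir by (meson irreflpD)
  show ?case
  proof (cases "P = {}")
    case True
    then show ?thesis by simp
  next
    case False
    have "\<exists>a\<in>P. \<forall>y\<in>P. y \<noteq> a \<longrightarrow> \<not> r a y"
      using Finite_Set.bex_max_element[of P r] psubset.hyps False tr' ir'
      by (metis asymp_on_def transp_on_def)
    then obtain a where a: "a \<in> P" and amax: "\<And>y. y \<in> P \<Longrightarrow> \<not> r a y"
      using ir' by metis
    define P' where "P' = P - {a}"
    have P': "P' \<subset> P" "finite P'" using a psubset.hyps by (auto simp: P'_def)
    let ?C = "card ` {A. A \<subseteq> P' \<and> anti A}"
    define v where "v = Max ?C"
    have finC: "finite ?C" using P' by simp
    have "{} \<in> {A. A \<subseteq> P' \<and> anti A}" by (simp add: anti_def)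
    then have "v \<in> ?C" unfolding v_def using finC by (intro Max_in) blast+
    then obtain A0 where A0: "A0 \<subseteq> P'" "anti A0" "card A0 = v" by auto
    have vmax: "card A \<le> v" if "A \<subseteq> P'" "anti A" for A
      unfolding v_def using finC that by (intro Max_ge) auto
    have "v \<le> w" using psubset.prems[of A0] A0 P' by (auto simp: anti_def)
    obtain h :: "'a \<Rightarrow> nat" where col: "\<And>x. x \<in> P' \<Longrightarrow> h x < v"
      and chain: "\<And>x y. x \<in> P' \<Longrightarrow> y \<in> P' \<Longrightarrow> h x = h y \<Longrightarrow> x = y \<or> r x y \<or> r y x"
      using psubset.IH[OF P'(1), of v] vmax unfolding anti_def by blast
    have meets: "\<exists>x\<in>A. h x = i" if "A \<subseteq> P'" "anti A" "card A = v" "i < v" for A i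
    proof -
      have "inj_on h A" using that chain unfolding inj_on_def anti_def by (metis subsetD)
      then have "card (h ` A) = v" using that by (simp add: card_image)
      moreover have "h ` A \<subseteq> {..<v}" using col that by auto
      ultimately have "h ` A = {..<v}" by (intro card_subset_eq) auto
      then show ?thesis using \<open>i < v\<close> by (metis imageE lessThan_iff)
    qed
    define X where "X = (\<lambda>i. {x \<in> P'. h x = i \<and> (\<exists>A\<subseteq>P'. anti A \<and> card A = v \<and> x \<in> A)})"
    have "\<exists>x\<in>X i. \<forall>y\<in>X i. y = x \<or> r y x" if i: "i < v" for i
    proof -
      have "X i \<noteq> {}" using meets[OF A0 i] A0 unfolding X_def by blast
      moreover have "finite (X i)" using P' unfolding X_def by simp
      ultimately have "\<exists>x\<in>X i. \<forall>y\<in>X i. y \<noteq> x \<longrightarrow> \<not> r x y"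
        using Finite_Set.bex_max_element[of "X i" r] tr' ir'
        by (metis asymp_on_def transp_on_def)
      moreover have "x = y \<or> r x y \<or> r y x" if "x \<in> X i" "y \<in> X i" for x y
        using that chain unfolding X_def by auto
      ultimately show ?thesis by metis
    qed
    then obtain t where tX: "\<And>i. i < v \<Longrightarrow> t i \<in> X i"
      and tmax: "\<And>i y. i < v \<Longrightarrow> y \<in> X i \<Longrightarrow> y = t i \<or> r y (t i)" by metis
    have tP: "t i \<in> P'" "h (t i) = i" if "i < v" for i using tX[OF that] by (auto simp: X_def)
    \<comment> \<open>If \<open>t i\<close> were below \<open>t j\<close>, then the element of colour \<open>i\<close> in a largest antichain
      through \<open>t j\<close> would be at most \<open>t i\<close>, hence below \<open>t j\<close>.\<close>
    have tanti: "\<not> r (t i) (t j)" if ij: "i < v" "j < v" for i j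
    proof
      assume rij: "r (t i) (t j)"
      obtain A where A: "A \<subseteq> P'" "anti A" "card A = v" "t j \<in> A"
        using tX[OF ij(2)] by (auto simp: X_def)
      obtain z where z: "z \<in> A" "h z = i" using meets[OF A(1-3) ij(1)] by auto
      have "z \<in> X i" using z A by (auto simp: X_def)
      then have "r z (t j)" using tmax[OF ij(1)] rij tr' by blast
      then show False using z A by (auto simp: anti_def)
    qed
    show ?thesis
    proof (cases "\<exists>i<v. r (t i) a")
      case False
      let ?A = "insert a (t ` {..<v})"
      have "inj_on t {..<v}" using tP by (metis inj_onI lessThan_iff)
      moreover have "a \<notin> t ` {..<v}" using tP by (auto simp: P'_def)
      ultimately have "card ?A = Suc v" by (simp add: card_image)
      moreover have "card ?A \<le> w"
      proof (rule psubset.prems)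
        show "?A \<subseteq> P" using a tP P' by auto
        show "\<forall>x\<in>?A. \<forall>y\<in>?A. \<not> r x y"
          using False tanti amax ir' tP P' a by blast
      qed
      ultimately have "v < w" by simp
      have PP: "x \<in> P'" if "x \<in> P" "x \<noteq> a" for x using that by (auto simp: P'_def)
      define \<phi> where "\<phi> = h(a := v)"
      have "\<phi> x < w" if "x \<in> P" for x
        using col[OF PP[OF that]] \<open>v < w\<close> by (cases "x = a") (simp_all add: \<phi>_def)
      moreover have "x = y \<or> r x y \<or> r y x" if "x \<in> P" "y \<in> P" "\<phi> x = \<phi> y" for x y
      proof (cases "x = a \<or> y = a")
        case True
        then show ?thesis using that col[OF PP, of x] col[OF PP, of y]
          by (auto simp: \<phi>_def split: if_splits)
      next
        case False
        then show ?thesis using chain[OF PP PP, of x y] that by (simp add: \<phi>_def)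
      qed
      ultimately show ?thesis by blast
    next
      case True
      then obtain i where i: "i < v" "r (t i) a" by auto
      define K where "K = insert a {z \<in> P'. h z = i \<and> (z = t i \<or> r z (t i))}"
      have "P - K \<subset> P" using a by (auto simp: K_def)
      moreover have "card A \<le> v - 1" if A: "A \<subseteq> P - K" "anti A" for A
      proof (rule ccontr)
        assume "\<not> card A \<le> v - 1"
        moreover have AP: "A \<subseteq> P'" using A by (auto simp: K_def P'_def)
        ultimately have "card A = v" using vmax[of A] A by simp
        then obtain z where z: "z \<in> A" "h z = i" using meets[OF AP A(2) _ i(1)] by auto
        have "z \<in> X i" using z A AP \<open>card A = v\<close> by (auto simp: X_def)
        then have "z \<in> K" using tmax[OF i(1)] z AP by (auto simp: K_def)
        then show False using z A by auto
      qed
      ultimately obtain \<psi> :: "'a \<Rightarrow> nat" where psi: "\<And>x. x \<in> P - K \<Longrightarrow> \<psi> x < v - 1"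
        "\<And>x y. x \<in> P - K \<Longrightarrow> y \<in> P - K \<Longrightarrow> \<psi> x = \<psi> y \<Longrightarrow> x = y \<or> r x y \<or> r y x"
        using psubset.IH[of "P - K" "v - 1"] unfolding anti_def by blast
      have Kbelow: "r x a" if "x \<in> K" "x \<noteq> a" for x
        using that i(2) tr'[of x "t i" a] by (auto simp: K_def)
      have Kchain: "x = y \<or> r x y \<or> r y x" if xy: "x \<in> K" "y \<in> K" for x y
      proof (cases "x = a \<or> y = a")
        case True
        then show ?thesis using Kbelow xy by auto
      next
        case False
        then show ?thesis using chain[of x y] xy by (auto simp: K_def)
      qed
      define \<phi> where "\<phi> = (\<lambda>x. if x \<in> K then v - 1 else \<psi> x)"
      have psi_less: "\<phi> x < v - 1" if "x \<in> P" "x \<notin> K" for x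
        using psi(1)[of x] that by (simp add: \<phi>_def)
      have "\<phi> x < w" if "x \<in> P" for x
        using psi_less[OF that] i(1) \<open>v \<le> w\<close> by (cases "x \<in> K") (simp_all add: \<phi>_def)
      moreover have "x = y \<or> r x y \<or> r y x" if xy: "x \<in> P" "y \<in> P" "\<phi> x = \<phi> y" for x y
      proof (cases "x \<in> K"; cases "y \<in> K")
        assume "x \<notin> K" "y \<notin> K"
        then show ?thesis using psi(2)[of x y] xy by (simp add: \<phi>_def)
      next
        assume "x \<in> K" "y \<notin> K"
        then show ?thesis using psi_less[of y] xy by (simp add: \<phi>_def)
      next
        assume "x \<notin> K" "y \<in> K"
        then show ?thesis using psi_less[of x] xy by (simp add: \<phi>_def)
      qed (rule Kchain)
      ultimately show ?thesis by blast
    qed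
  qed
qed

section \<open>Monotone curves as graphs of continuous functions\<close>

text \<open>The projection to the first coordinate is injective on the curve and the curve is compact, so the
  inverse of the projection is continuous.\<close>

lemma x_monotone_curve_graph:
  assumes "is_curve S" "x_monotone S"
  shows "\<exists>l r f. l \<le> r \<and> continuous_on {l..r} f \<and> S = (\<lambda>x. (x, f x :: real)) ` {l..r}"
proof -
  have hom: "S homeomorphic {0..1::real}" using assms(1) by (simp add: is_curve_def)
  have cpt: "compact S" using homeomorphic_compactness[OF hom] by simp
  have conn: "connected S" using homeomorphic_connectedness[OF hom] by simp
  have ne: "S \<noteq> {}" using hom by auto
  have inj: "inj_on fst S"
  proof (rule inj_onI)
    fix p q assume pq: "p \<in> S" "q \<in> S" "fst p = fst q"
    have "\<exists>\<^sub>\<le>\<^sub>1 p'. p' \<in> S \<inter> vertical_line (fst p)" using assms(2) by (simp add: x_monotone_def)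
    moreover have "p \<in> S \<inter> vertical_line (fst p)" "q \<in> S \<inter> vertical_line (fst p)"
      using pq by (auto simp: vertical_line_def)
    ultimately show "p = q" by (meson Uniq_D)
  qed
  have "compact (fst ` S)" "connected (fst ` S)"
    using cpt conn continuous_on_fst[OF continuous_on_id, of S]
    by (auto intro: compact_continuous_image connected_continuous_image)
  then obtain l r where lr: "fst ` S = {l..r}"
    using connected_compact_interval_1 by (metis)
  have "l \<le> r" using ne lr by (metis atLeastatMost_empty_iff image_is_empty)
  let ?g = "inv_into S fst"
  have cont: "continuous_on {l..r} ?g"
    using continuous_on_inv[OF continuous_on_fst[OF continuous_on_id] cpt, of ?g] inj lr
    by (metis inv_into_f_f)
  have g: "x \<in> {l..r} \<Longrightarrow> ?g x \<in> S \<and> fst (?g x) = x" for x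
    using lr by (metis f_inv_into_f inv_into_into)
  have "continuous_on {l..r} (\<lambda>x. snd (?g x))" using cont by (rule continuous_on_snd)
  moreover have "S = (\<lambda>x. (x, snd (?g x))) ` {l..r}"
  proof (intro equalityI subsetI)
    fix p assume p: "p \<in> S"
    then have "fst p \<in> {l..r}" "?g (fst p) = p" using lr inj by auto
    then show "p \<in> (\<lambda>x. (x, snd (?g x))) ` {l..r}" by (intro image_eqI[of _ _ "fst p"]) simp_all
  next
    fix p assume "p \<in> (\<lambda>x. (x, snd (?g x))) ` {l..r}"
    then obtain x where x: "x \<in> {l..r}" "p = (x, snd (?g x))" by blast
    then have "p = ?g x" using g[of x] by (simp add: prod_eq_iff)
    then show "p \<in> S" using g[OF x(1)] by simp
  qed
  ultimately show ?thesis using \<open>l \<le> r\<close> by blast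
qed

section \<open>Medians and small subsets\<close>

text \<open>The median is the least value with at least half of the indices at or below it. Ties are
  harmless, because indices with the median value itself are counted on neither side.\<close>

lemma median_exists:
  fixes v :: "'i \<Rightarrow> real"
  assumes "finite P" "P \<noteq> {}"
  shows "\<exists>c \<in> v ` P. card {i\<in>P. v i < c} \<le> card P div 2 \<and> card {i\<in>P. c < v i} \<le> card P div 2"
proof -
  define G where "G = {c \<in> v ` P. card P \<le> 2 * card {i\<in>P. v i \<le> c}}"
  have "{i\<in>P. v i \<le> Max (v ` P)} = P" using assms by auto
  then have "Max (v ` P) \<in> G" using assms by (auto simp: G_def)
  moreover have "finite G" using assms by (auto simp: G_def)
  ultimately have c: "Min G \<in> G" "\<And>d. d \<in> G \<Longrightarrow> Min G \<le> d" by (auto intro: Min_in)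
  define c where "c = Min G"
  have "2 * card {i\<in>P. v i < c} \<le> card P"
  proof (cases "{i\<in>P. v i < c} = {}")
    case False
    then have ne: "v ` {i\<in>P. v i < c} \<noteq> {}" by blast
    define d where "d = Max (v ` {i\<in>P. v i < c})"
    have d: "d \<in> v ` {i\<in>P. v i < c}" "\<And>i. i \<in> P \<Longrightarrow> v i < c \<Longrightarrow> v i \<le> d"
      unfolding d_def using Max_in[OF _ ne] assms by auto
    then have "d \<notin> G" using c unfolding c_def by fastforce
    moreover have "{i\<in>P. v i < c} = {i\<in>P. v i \<le> d}" using d by force
    ultimately show ?thesis using d by (auto simp: G_def)
  next
    case True
    then show ?thesis by (metis card.empty mult_0_right zero_le)
  qed
  moreover have "card P = card {i\<in>P. v i \<le> c} + card {i\<in>P. c < v i}"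
    using assms by (subst card_Un_disjoint[symmetric]) (auto intro!: arg_cong[of _ _ card])
  ultimately show ?thesis using c unfolding c_def G_def by (intro bexI[of _ "Min G"]) (auto simp: G_def)
qed

text \<open>A subset with at most \<open>t\<close> elements arises by \<open>t\<close> times either adding an element of \<open>U\<close> or
  doing nothing.\<close>

lemma card_subsets_le_power:
  assumes "finite U"
  shows "card {X. X \<subseteq> U \<and> card X \<le> t} \<le> (card U + 1) ^ t"
proof (induction t)
  case 0
  have "{X. X \<subseteq> U \<and> card X \<le> 0} = {{}}" using assms by (auto dest: finite_subset)
  then show ?case by simp
next
  case (Suc t)
  let ?F = "\<lambda>t. {X. X \<subseteq> U \<and> card X \<le> t}"
  let ?add = "\<lambda>(X, z). case z of None \<Rightarrow> X | Some x \<Rightarrow> insert x X"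
  let ?O = "insert None (Some ` U)"
  have "?F (Suc t) \<subseteq> ?add ` (?F t \<times> ?O)"
  proof
    fix X assume X: "X \<in> ?F (Suc t)"
    show "X \<in> ?add ` (?F t \<times> ?O)"
    proof (cases "X = {}")
      case True
      then have "X = ?add ({}, None)" by simp
      then show ?thesis by (rule image_eqI) auto
    next
      case False
      then obtain x where x: "x \<in> X" by auto
      then have "X = ?add (X - {x}, Some x)" by auto
      then show ?thesis
        by (rule image_eqI) (use X x assms in \<open>auto simp: card_Diff_singleton dest: finite_subset\<close>)
    qed
  qed
  then have "card (?F (Suc t)) \<le> card (?F t \<times> ?O)"
    using assms by (intro surj_card_le) auto
  also have "\<dots> = card (?F t) * (card U + 1)"
    using assms by (simp add: card_cartesian_product card_image)
  also have "\<dots> \<le> (card U + 1) ^ t * (card U + 1)" using Suc by (rule mult_le_mono1)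
  finally show ?case by (simp only: power_Suc mult.commute)
qed
section \<open>Curves over a slab\<close>

lemma continuous_zero_between:
  fixes g :: "real \<Rightarrow> real"
  assumes "is_interval I" "continuous_on I g" "x \<in> I" "y \<in> I" "g x \<le> 0" "0 \<le> g y"
  shows "\<exists>z\<in>I. g z = 0"
proof -
  have "connected I" using assms(1) by (rule is_interval_connected_1[THEN iffD1])
  with assms(2) have "connected (g ` I)" by (rule connected_continuous_image)
  then have "is_interval (g ` I)" by (rule is_interval_connected_1[THEN iffD2])
  then have "0 \<in> g ` I" using assms(3-6) mem_is_interval_1_I[of "g ` I" "g x" "g y" 0] by blast
  then show ?thesis by (metis imageE)
qed

locale curves =
  fixes V :: "'v set" and l r :: "'v \<Rightarrow> real" and f :: "'v \<Rightarrow> real \<Rightarrow> real"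
  assumes finite_V: "finite V"
    and l_le_r: "i \<in> V \<Longrightarrow> l i \<le> r i"
    and cont: "i \<in> V \<Longrightarrow> continuous_on {l i..r i} (f i)"
begin

definition meets :: "real set \<Rightarrow> 'v \<Rightarrow> 'v \<Rightarrow> bool" where
  "meets I i j \<longleftrightarrow> (\<exists>x\<in>I. x \<in> {l i..r i} \<and> x \<in> {l j..r j} \<and> f i x = f j x)"

definition spans :: "real set \<Rightarrow> 'v \<Rightarrow> bool" where
  "spans I i \<longleftrightarrow> I \<subseteq> {l i..r i}"

text \<open>The disjoint sum keeps left and right endpoints apart, so every curve contributes two endpoints
  even when endpoints coincide.\<close>

definition ends :: "real set \<Rightarrow> ('v + 'v) set" where
  "ends I = {e \<in> V <+> V. case_sum l r e \<in> I}"

definition inner :: "real set \<Rightarrow> 'v set" where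
  "inner I = {i \<in> V. l i \<in> I \<or> r i \<in> I}"

definition inner_edges :: "real set \<Rightarrow> 'v set set" where
  "inner_edges I = {{i, j} | i j. i \<in> inner I \<and> j \<in> inner I \<and> i \<noteq> j \<and> meets I i j}"

text \<open>Edges at spanning curves need no recursion: a decomposition of the spanning curves into chains
  encodes them.\<close>

definition span_edges :: "real set \<Rightarrow> 'v set \<Rightarrow> 'v set set" where
  "span_edges I S = {{i, j} | i j. i \<in> S \<and> j \<in> S \<and> i \<noteq> j \<and> spans I i \<and> meets I i j}"

definition below :: "real set \<Rightarrow> 'v \<Rightarrow> 'v \<Rightarrow> bool" where
  "below I i j \<longleftrightarrow> (\<forall>x\<in>I. f i x < f j x)"

lemma finite_ends: "finite (ends I)"
  using finite_V by (simp add: ends_def)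

lemma meets_commute: "meets I i j \<longleftrightarrow> meets I j i"
  unfolding meets_def by metis

lemma meets_mono: "meets I i j \<Longrightarrow> I \<subseteq> J \<Longrightarrow> meets J i j"
  unfolding meets_def by blast

lemma card_inner_le: "card (inner I) \<le> card (ends I)"
proof -
  have "inner I \<subseteq> case_sum id id ` ends I"
  proof
    fix i assume "i \<in> inner I"
    then have "Inl i \<in> ends I \<or> Inr i \<in> ends I" by (auto simp: inner_def ends_def)
    then show "i \<in> case_sum id id ` ends I" by force
  qed
  then show ?thesis by (rule surj_card_le[OF finite_ends])
qed

text \<open>A convex set that contains a point between the endpoints of a curve, but neither endpoint, lies
  between them.\<close>

lemma inner_or_spans:
  assumes "i \<in> V" "is_interval I" "meets I i j"
  shows "i \<in> inner I \<or> spans I i"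
proof (rule ccontr)
  assume "\<not> ?thesis"
  then have not_in: "l i \<notin> I" "r i \<notin> I" and "\<not> I \<subseteq> {l i..r i}"
    using assms(1) by (auto simp: inner_def spans_def)
  then obtain y where y: "y \<in> I" "y < l i \<or> r i < y" by force
  obtain x where x: "x \<in> I" "l i \<le> x" "x \<le> r i" using assms(3) by (auto simp: meets_def)
  show False
    using y(2) mem_is_interval_1_I[OF assms(2) y(1) x(1), of "l i"]
      mem_is_interval_1_I[OF assms(2) x(1) y(1), of "r i"] x not_in by force
qed

text \<open>The recursion step. The middle slab \<open>{c}\<close> is treated like the others, except that every
  curve with an endpoint over it also spans it, so it needs no recursive term.\<close>

lemma inner_edges_split:
  assumes J: "is_interval J" "c \<in> J"
  shows "inner_edges J =
    inner_edges (J \<inter> {..<c}) \<union> inner_edges (J \<inter> {c<..}) \<union>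
    span_edges (J \<inter> {..<c}) (inner J) \<union> span_edges {c} (inner J) \<union>
    span_edges (J \<inter> {c<..}) (inner J)" (is "_ = ?R")
proof (intro equalityI subsetI)
  fix e assume "e \<in> ?R"
  moreover have "inner_edges I \<subseteq> inner_edges J" "span_edges I (inner J) \<subseteq> inner_edges J"
    if "I \<subseteq> J" for I
  proof -
    have "inner I \<subseteq> inner J" using that by (auto simp: inner_def)
    then show "inner_edges I \<subseteq> inner_edges J" "span_edges I (inner J) \<subseteq> inner_edges J"
      unfolding inner_edges_def span_edges_def using meets_mono[OF _ that] by blast+
  qed
  moreover have "J \<inter> {..<c} \<subseteq> J" "J \<inter> {c<..} \<subseteq> J" "{c} \<subseteq> J" using J by auto
  ultimately show "e \<in> inner_edges J" by blast
next
  fix e assume "e \<in> inner_edges J"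
  then obtain i j where e: "e = {i, j}" "i \<in> inner J" "j \<in> inner J" "i \<noteq> j" "meets J i j"
    by (auto simp: inner_edges_def)
  have V: "i \<in> V" "j \<in> V" using e by (auto simp: inner_def)
  have "J = J \<inter> {..<c} \<union> {c} \<union> J \<inter> {c<..}" using J by auto
  then have "meets (J \<inter> {..<c}) i j \<or> meets {c} i j \<or> meets (J \<inter> {c<..}) i j"
    using e(5) unfolding meets_def by blast
  moreover have step: "e \<in> inner_edges I \<union> span_edges I (inner J)"
    if I: "meets I i j" "is_interval I" for I
  proof (cases "spans I i \<or> spans I j")
    case True
    then show ?thesis using e I(1) meets_commute[of I i j]
      unfolding span_edges_def by (auto simp: doubleton_eq_iff)
  next
    case False
    then show ?thesis using inner_or_spans[OF V(1) I(2,1)] inner_or_spans[OF V(2) I(2), of i]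
        I(1) meets_commute[of I i j] e unfolding inner_edges_def by auto
  qed
  moreover have ints: "is_interval (J \<inter> {..<c})" "is_interval (J \<inter> {c<..})" "is_interval {c}"
    using J by (auto intro: is_interval_Int simp: is_interval_convex_1[of "{c}"])
  moreover have "inner_edges {c} \<subseteq> span_edges {c} (inner J)"
  proof
    fix e assume "e \<in> inner_edges {c}"
    then obtain i j where "e = {i, j}" "i \<in> inner {c}" "j \<in> inner {c}" "i \<noteq> j" "meets {c} i j"
      by (auto simp: inner_edges_def)
    moreover from this have "spans {c} i" by (auto simp: meets_def spans_def)
    moreover have "inner {c} \<subseteq> inner J" using J by (auto simp: inner_def)
    ultimately show "e \<in> span_edges {c} (inner J)" unfolding span_edges_def by blast
  qed
  ultimately show "e \<in> ?R" using step[OF _ ints(1)] step[OF _ ints(2)] step[OF _ ints(3)] by auto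
qed

lemma disjoint_comparable:
  assumes "is_interval I" "i \<in> V" "j \<in> V" "spans I i" "spans I j" "\<not> meets I i j"
  shows "below I i j \<or> below I j i"
proof (rule ccontr)
  assume "\<not> ?thesis"
  then obtain x y where xy: "x \<in> I" "y \<in> I" "f i x \<ge> f j x" "f j y \<ge> f i y"
    unfolding below_def by force
  have "continuous_on I (\<lambda>x. f j x - f i x)"
    using assms cont[of i] cont[of j] unfolding spans_def
    by (intro continuous_on_diff) (auto intro: continuous_on_subset)
  then obtain z where "z \<in> I" "f j z - f i z = 0"
    using continuous_zero_between[OF assms(1) _ xy(1,2), of "\<lambda>x. f j x - f i x"] xy by auto
  moreover have "z \<in> {l i..r i}" "z \<in> {l j..r j}"
    using assms(4,5) \<open>z \<in> I\<close> unfolding spans_def by blast+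
  ultimately have "meets I i j" unfolding meets_def by (intro bexI[of _ z]) auto
  then show False using assms(6) by contradiction
qed

text \<open>Over the connected set of abscissae in \<open>I\<close> at which \<open>j\<close> is defined, \<open>j\<close> is at the height of \<open>a\<close>,
  below \<open>b\<close>, somewhere and at the height of \<open>c\<close>, above \<open>b\<close>, somewhere else.\<close>

lemma meets_between:
  assumes "is_interval I" "b \<in> V" "j \<in> V" "spans I b"
    and "below I a b" "below I b c" "meets I a j" "meets I c j"
  shows "meets I b j"
proof -
  obtain x where x: "x \<in> I" "x \<in> {l j..r j}" "f a x = f j x"
    using assms(7) unfolding meets_def by auto
  obtain y where y: "y \<in> I" "y \<in> {l j..r j}" "f c y = f j y"
    using assms(8) unfolding meets_def by auto
  have "is_interval (I \<inter> {l j..r j})" using assms(1) by (intro is_interval_Int is_interval_cc)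
  moreover have "continuous_on (I \<inter> {l j..r j}) (\<lambda>x. f j x - f b x)"
    using assms cont[of b] cont[of j] unfolding spans_def
    by (intro continuous_on_diff) (auto intro: continuous_on_subset)
  moreover have "f j x - f b x \<le> 0" "0 \<le> f j y - f b y"
    using assms(5,6) x y unfolding below_def by (auto intro: less_imp_le)
  ultimately obtain z where "z \<in> I \<inter> {l j..r j}" "f j z - f b z = 0"
    using continuous_zero_between[of "I \<inter> {l j..r j}" "\<lambda>x. f j x - f b x" x y] x y by auto
  then show ?thesis using assms(4) unfolding meets_def spans_def by (intro bexI[of _ z]) auto
qed

text \<open>Each class of the colouring \<open>h\<close> is a chain, in which a curve is located by the number
  of curves of its class below it. By \<open>meets_between\<close>, the members of a class that \<open>j\<close>
  meets are consecutive; their heights form the half-open interval from \<open>u\<close> to \<open>v\<close>, which may be empty.\<close>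

lemma hits_are_rank_interval:
  assumes I: "is_interval I" "I \<noteq> {}" and M: "M \<subseteq> V" "\<And>i. i \<in> M \<Longrightarrow> spans I i"
    and j: "j \<in> V"
    and chain: "\<And>i i'. i \<in> M \<Longrightarrow> i' \<in> M \<Longrightarrow> h i = h i' \<Longrightarrow> i = i' \<or> below I i i' \<or> below I i' i"
  defines "height \<equiv> \<lambda>i. card {i' \<in> M. h i' = h i \<and> below I i' i}"
  shows "\<exists>u \<le> card V. \<exists>v \<le> card V. \<forall>i\<in>M. h i = a \<longrightarrow> (meets I i j \<longleftrightarrow> u \<le> height i \<and> height i < v)"
proof -
  have finM: "finite M" using M(1) finite_V by (rule finite_subset)
  have irr: "\<not> below I i i" for i using I by (auto simp: below_def)
  have trans: "below I i j \<Longrightarrow> below I j k \<Longrightarrow> below I i k" for i j k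
    unfolding below_def by force
  have height_less: "height i < height i'" if "i \<in> M" "i' \<in> M" "h i = h i'" "below I i i'" for i i'
  proof -
    have "i \<in> {x \<in> M. h x = h i' \<and> below I x i'} - {x \<in> M. h x = h i \<and> below I x i}"
      using that irr by simp
    moreover have "{x \<in> M. h x = h i \<and> below I x i} \<subseteq> {x \<in> M. h x = h i' \<and> below I x i'}"
      using that trans by auto
    ultimately show ?thesis unfolding height_def using finM by (intro psubset_card_mono) auto
  qed
  have height_V: "height i < card V" if "i \<in> M" for i
    unfolding height_def using that M finite_V irr[of i]
    by (intro psubset_card_mono) auto
  define H where "H = {i \<in> M. h i = a \<and> meets I i j}"
  show ?thesis
  proof (cases "H = {}")
    case True
    then show ?thesis by (intro exI[of _ 0]) (auto simp: H_def)
  next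
    case False
    have R: "finite (height ` H)" "height ` H \<noteq> {}" using finM False by (auto simp: H_def)
    obtain p where p: "p \<in> H" "height p = Min (height ` H)" using Min_in[OF R] by auto
    obtain q where q: "q \<in> H" "height q = Max (height ` H)" using Max_in[OF R] by auto
    have "meets I i j" if i: "i \<in> M" "h i = a" "height p \<le> height i" "height i < Suc (height q)" for i
    proof -
      have pq: "p \<in> M" "h p = a" "meets I p j" "q \<in> M" "h q = a" "meets I q j"
        using p q by (auto simp: H_def)
      have "p = i \<or> below I p i"
        using chain[of p i] height_less[of i p] pq i by fastforce
      moreover have "q = i \<or> below I i q"
        using chain[of q i] height_less[of q i] pq i by fastforce
      ultimately show ?thesis
        using meets_between[OF I(1) _ j, of i p q] M i(1) pq by blast
    qed
    moreover have "height p \<le> height i \<and> height i < Suc (height q)" if "i \<in> H" for i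
      using that p q R by (simp add: le_imp_less_Suc)
    moreover have "height p \<le> card V" "Suc (height q) \<le> card V"
      using height_V[of p] height_V[of q] p(1) q(1) by (simp_all add: H_def)
    ultimately show ?thesis by (intro exI[of _ "height p"] exI[of _ "Suc (height q)"] conjI) (auto simp: H_def)
  qed
qed

end

section \<open>Encoding the edges at spanning curves\<close>

text \<open>A triple \<open>(i, a, s)\<close> in \<open>D\<close> places the spanning curve \<open>i\<close> at height \<open>s\<close> of chain \<open>a\<close>. A tuple
  \<open>(j, a, u, v)\<close> in \<open>E\<close> states that \<open>j\<close> meets exactly the curves of chain \<open>a\<close> whose height is at
  least \<open>u\<close> and less than \<open>v\<close>.\<close>

definition decode :: "('v \<times> nat \<times> nat) set \<Rightarrow> ('v \<times> nat \<times> nat \<times> nat) set \<Rightarrow> 'v set set" where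
  "decode D E = {{i, j} | i j. \<exists>a s u v. (i, a, s) \<in> D \<and> (j, a, u, v) \<in> E \<and> i \<noteq> j \<and> u \<le> s \<and> s < v}"

definition codes :: "'v set \<Rightarrow> nat \<Rightarrow> nat \<Rightarrow> 'v set set set" where
  "codes V k p = (\<lambda>(D, E). decode D E) `
     ({D. D \<subseteq> V \<times> {..<k} \<times> {..<card V} \<and> card D \<le> p} \<times>
      {E. E \<subseteq> V \<times> {..<k} \<times> {..card V} \<times> {..card V} \<and> card E \<le> k * p})"

text \<open>Both kinds of tuples come from a set with fewer than \<open>n ^ 7\<close> elements, and a code is a choice of
  at most \<open>p + k * p\<close> of them.\<close>

lemma card_codes_le:
  assumes "finite V" "card V = n" "2 \<le> n" "1 \<le> k" "k \<le> n"
  shows "finite (codes V k p)" "card (codes V k p) \<le> n ^ (14 * k * p)"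
proof -
  let ?U = "V \<times> {..<k} \<times> {..<card V}" and ?W = "V \<times> {..<k} \<times> {..card V} \<times> {..card V}"
  let ?A = "{D. D \<subseteq> ?U \<and> card D \<le> p}" and ?B = "{D. D \<subseteq> ?W \<and> card D \<le> k * p}"
  have fin: "finite ?U" "finite ?W" using assms by auto
  have finAB: "finite ?A" "finite ?B"
    by (rule finite_subset[of _ "Pow ?U"] finite_subset[of _ "Pow ?W"], blast, simp only: finite_Pow_iff fin)+
  then show "finite (codes V k p)" unfolding codes_def by simp
  have sq: "n + 1 \<le> n ^ 2" using \<open>2 \<le> n\<close> mult_le_mono1[of 2 n n] unfolding power2_eq_square by linarith
  have "n * k * ((n + 1) * (n + 1)) \<le> n * n * (n ^ 2 * n ^ 2)"
    using sq assms by (intro mult_le_mono) auto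
  also have "\<dots> = n ^ 6" by (simp add: power_add[symmetric] flip: power2_eq_square)
  finally have "card ?W \<le> n ^ 6" using assms by (simp add: card_cartesian_product algebra_simps)
  moreover have "n ^ 6 + 1 \<le> n ^ 6 * 2" using assms by simp
  moreover have "n ^ 6 * 2 \<le> n ^ 6 * n" using assms by (intro mult_le_mono) auto
  moreover have "n ^ 6 * n = n ^ 7" by (simp add: power_Suc2[symmetric])
  ultimately have W: "card ?W + 1 \<le> n ^ 7" by linarith
  have "n * (k * n) \<le> n * (k * ((n + 1) * (n + 1)))" by (intro mult_le_mono) auto
  then have "card ?U \<le> card ?W"
    using assms by (simp add: card_cartesian_product)
  then have U: "card ?U + 1 \<le> n ^ 7" using W by linarith
  have "card (codes V k p) \<le> card (?A \<times> ?B)"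
    unfolding codes_def using finAB by (intro card_image_le) auto
  also have "\<dots> = card ?A * card ?B" by (rule card_cartesian_product)
  also have "\<dots> \<le> (n ^ 7) ^ p * (n ^ 7) ^ (k * p)"
    using card_subsets_le_power[OF fin(1), of p] card_subsets_le_power[OF fin(2), of "k * p"]
      power_mono[OF U, of p] power_mono[OF W, of "k * p"]
    by (intro mult_le_mono) linarith+
  also have "\<dots> = n ^ (7 * p + 7 * (k * p))" by (simp add: power_mult power_add)
  also have "\<dots> \<le> n ^ (14 * k * p)"
    using assms mult_le_mono1[of 1 k p] by (intro power_increasing) auto
  finally show "card (codes V k p) \<le> n ^ (14 * k * p)" .
qed

locale bounded_clique_curves = curves +
  fixes k :: nat
  assumes clique_le: "K \<subseteq> V \<Longrightarrow> \<forall>i\<in>K. \<forall>j\<in>K. i \<noteq> j \<longrightarrow> meets UNIV i j \<Longrightarrow> card K \<le> k"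
begin

text \<open>An antichain of the order \<open>below I\<close> on the spanning curves is a clique, so Dilworth's theorem
  splits these curves into \<open>k\<close> chains, and \<open>hits_are_rank_interval\<close> supplies the tuples.\<close>

lemma span_edges_in_codes:
  assumes "is_interval I" "S \<subseteq> V" "card S \<le> p"
  shows "span_edges I S \<in> codes V k p"
proof (cases "I = {}")
  case True
  then have "span_edges I S = decode {} {}" by (auto simp: span_edges_def decode_def meets_def)
  then show ?thesis unfolding codes_def by (intro image_eqI[of _ _ "({}, {})"]) auto
next
  case False
  define M where "M = {i \<in> S. spans I i}"
  have M: "M \<subseteq> V" "M \<subseteq> S" "\<And>i. i \<in> M \<Longrightarrow> spans I i" using assms by (auto simp: M_def)
  have fin: "finite S" "finite M"
    using finite_subset[OF assms(2) finite_V] finite_subset[OF M(1) finite_V] by auto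
  have "\<exists>h :: 'a \<Rightarrow> nat. (\<forall>x\<in>M. h x < k) \<and>
           (\<forall>x\<in>M. \<forall>y\<in>M. h x = h y \<longrightarrow> x = y \<or> below I x y \<or> below I y x)"
  proof (rule dilworth)
    show "transp (below I)" unfolding below_def by (rule transpI) force
    show "irreflp (below I)" using False unfolding below_def by (auto intro: irreflpI)
    fix A assume A: "A \<subseteq> M" "\<forall>x\<in>A. \<forall>y\<in>A. \<not> below I x y"
    show "card A \<le> k"
    proof (rule clique_le)
      show "A \<subseteq> V" using A M by blast
      show "\<forall>i\<in>A. \<forall>j\<in>A. i \<noteq> j \<longrightarrow> meets UNIV i j"
        using disjoint_comparable[OF assms(1)] A M meets_mono[of I _ _ UNIV] by (metis subset_UNIV subsetD)
    qed
  qed (rule fin)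
  then obtain h :: "'a \<Rightarrow> nat" where h: "\<And>x. x \<in> M \<Longrightarrow> h x < k"
    and chain: "\<And>x y. x \<in> M \<Longrightarrow> y \<in> M \<Longrightarrow> h x = h y \<Longrightarrow> x = y \<or> below I x y \<or> below I y x"
    by blast
  define height where "height = (\<lambda>i. card {i' \<in> M. h i' = h i \<and> below I i' i})"
  have "\<exists>u \<le> card V. \<exists>v \<le> card V. \<forall>i\<in>M. h i = a \<longrightarrow> (meets I i j \<longleftrightarrow> u \<le> height i \<and> height i < v)"
    if "j \<in> S" for j a
    unfolding height_def
    by (rule hits_are_rank_interval) (use assms False M that chain in auto)
  then obtain u v where u: "\<And>j a. j \<in> S \<Longrightarrow> u j a \<le> card V" and v: "\<And>j a. j \<in> S \<Longrightarrow> v j a \<le> card V"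
    and uv: "\<And>j a i. j \<in> S \<Longrightarrow> i \<in> M \<Longrightarrow> h i = a \<Longrightarrow> meets I i j \<longleftrightarrow> u j a \<le> height i \<and> height i < v j a"
    by metis
  have height: "height i < card V" if "i \<in> M" for i
    unfolding height_def using that M finite_V False
    by (intro psubset_card_mono) (auto simp: below_def)
  define D where "D = (\<lambda>i. (i, h i, height i)) ` M"
  define E where "E = (\<lambda>(j, a). (j, a, u j a, v j a)) ` (S \<times> {..<k})"
  have "D \<subseteq> V \<times> {..<k} \<times> {..<card V}" using M h height by (auto simp: D_def)
  moreover have "E \<subseteq> V \<times> {..<k} \<times> {..card V} \<times> {..card V}" using assms u v by (auto simp: E_def)
  moreover have "card D \<le> p"
    using card_image_le[OF fin(2)] card_mono[OF fin(1) M(2)] assms(3) unfolding D_def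
    by (meson order_trans)
  moreover have "card E \<le> k * p"
  proof -
    have "card E \<le> card (S \<times> {..<k})" unfolding E_def using fin by (intro card_image_le) auto
    also have "\<dots> \<le> k * p" using assms by (simp add: card_cartesian_product mult.commute)
    finally show ?thesis .
  qed
  moreover have "span_edges I S = decode D E"
  proof -
    have "(i \<in> S \<and> j \<in> S \<and> i \<noteq> j \<and> spans I i \<and> meets I i j) \<longleftrightarrow>
      (\<exists>a s u v. (i, a, s) \<in> D \<and> (j, a, u, v) \<in> E \<and> i \<noteq> j \<and> u \<le> s \<and> s < v)" for i j
    proof -
      have "(i \<in> S \<and> j \<in> S \<and> i \<noteq> j \<and> spans I i \<and> meets I i j) \<longleftrightarrow>
        i \<in> M \<and> j \<in> S \<and> i \<noteq> j \<and> u j (h i) \<le> height i \<and> height i < v j (h i)"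
        using uv[of j i "h i"] by (auto simp: M_def)
      also have "\<dots> \<longleftrightarrow> (\<exists>a s u v. (i, a, s) \<in> D \<and> (j, a, u, v) \<in> E \<and> i \<noteq> j \<and> u \<le> s \<and> s < v)"
      proof
        assume *: "i \<in> M \<and> j \<in> S \<and> i \<noteq> j \<and> u j (h i) \<le> height i \<and> height i < v j (h i)"
        then have "(i, h i, height i) \<in> D" "(j, h i, u j (h i), v j (h i)) \<in> E"
          using h unfolding D_def E_def by force+
        then show "\<exists>a s u v. (i, a, s) \<in> D \<and> (j, a, u, v) \<in> E \<and> i \<noteq> j \<and> u \<le> s \<and> s < v"
          using * by blast
      qed (auto simp: D_def E_def)
      finally show ?thesis .
    qed
    then show ?thesis unfolding span_edges_def decode_def by presburger
  qed
  ultimately show ?thesis unfolding codes_def by (intro image_eqI[of _ _ "(D, E)"]) auto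
qed

end

section \<open>Divide and conquer\<close>

text \<open>The curves and the slab are quantified inside the definition: the family then depends
  only on the number of endpoints, and its size satisfies a recurrence.\<close>

definition slab_graphs :: "'v set \<Rightarrow> nat \<Rightarrow> nat \<Rightarrow> 'v set set set" where
  "slab_graphs V k p = {E. \<exists>l r f J. bounded_clique_curves V l r f k \<and> is_interval J \<and>
     card (curves.ends V l r J) \<le> p \<and> E = curves.inner_edges V l r f J}"

lemma slab_graphs_zero: "slab_graphs V k 0 \<subseteq> {{}}"
proof
  fix E assume "E \<in> slab_graphs V k 0"
  then obtain l r f J where c: "bounded_clique_curves V l r f k"
    and J: "card (curves.ends V l r J) \<le> 0" and E: "E = curves.inner_edges V l r f J"
    by (auto simp: slab_graphs_def)
  interpret bounded_clique_curves V l r f k by (rule c)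
  have "card (inner J) = 0" using J card_inner_le[of J] by simp
  then have "inner J = {}" using finite_V by (simp add: inner_def)
  then show "E \<in> {{}}" by (simp add: E inner_edges_def)
qed

lemma slab_graphs_split:
  assumes "p > 0"
  shows "slab_graphs V k p \<subseteq> (\<lambda>(A, B, C, D, E). A \<union> B \<union> C \<union> D \<union> E) `
    (slab_graphs V k (p div 2) \<times> slab_graphs V k (p div 2) \<times> codes V k p \<times> codes V k p \<times> codes V k p)"
    (is "_ \<subseteq> ?R")
proof
  fix E assume "E \<in> slab_graphs V k p"
  then obtain l r f J where c: "bounded_clique_curves V l r f k" and J: "is_interval J"
    and p: "card (curves.ends V l r J) \<le> p" and E: "E = curves.inner_edges V l r f J"
    by (auto simp: slab_graphs_def)
  interpret bounded_clique_curves V l r f k by (rule c)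
  show "E \<in> ?R"
  proof (cases "ends J = {}")
    case True
    have "card (inner J) = 0" using True card_inner_le[of J] by simp
    then have "inner J = {}" using finite_V by (simp add: inner_def)
    then have "E = {}" by (simp add: E inner_edges_def)
    moreover have "{} \<in> slab_graphs V k (p div 2)"
    proof -
      have "inner_edges {} = {}" "ends {} = {}" by (auto simp: inner_edges_def inner_def ends_def)
      then show ?thesis unfolding slab_graphs_def using c
        by (intro CollectI exI[of _ l] exI[of _ r] exI[of _ f] exI[of _ "{}"]) auto
    qed
    moreover have "{} \<in> codes V k p"
      using span_edges_in_codes[of "{}" "{}" p] by (simp add: span_edges_def)
    ultimately show ?thesis by (intro image_eqI[of _ _ "({}, {}, {}, {}, {})"]) auto
  next
    case False
    obtain c where c': "c \<in> case_sum l r ` ends J"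
      "card {e \<in> ends J. case_sum l r e < c} \<le> card (ends J) div 2"
      "card {e \<in> ends J. c < case_sum l r e} \<le> card (ends J) div 2"
      using median_exists[OF finite_ends False, of "case_sum l r"] by blast
    let ?L = "J \<inter> {..<c}" and ?R = "J \<inter> {c<..}"
    have "c \<in> J" using c'(1) by (auto simp: ends_def)
    have "ends ?L = {e \<in> ends J. case_sum l r e < c}" "ends ?R = {e \<in> ends J. c < case_sum l r e}"
      by (auto simp: ends_def)
    then have small: "card (ends ?L) \<le> p div 2" "card (ends ?R) \<le> p div 2"
      using c'(2,3) p div_le_mono[OF p, of 2] by auto
    have ints: "is_interval ?L" "is_interval ?R" "is_interval {c}"
      using J by (auto intro: is_interval_Int simp: is_interval_convex_1[of "{c}"])
    have rec: "inner_edges ?L \<in> slab_graphs V k (p div 2)" "inner_edges ?R \<in> slab_graphs V k (p div 2)"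
      using small ints c unfolding slab_graphs_def by blast+
    have "inner J \<subseteq> V" "card (inner J) \<le> p" using card_inner_le[of J] p by (auto simp: inner_def)
    then have "span_edges I (inner J) \<in> codes V k p" if "is_interval I" for I
      using span_edges_in_codes[OF that] by blast
    then show ?thesis using rec ints unfolding E inner_edges_split[OF J \<open>c \<in> J\<close>]
      by (intro image_eqI[of _ _ "(inner_edges ?L, inner_edges ?R, span_edges ?L (inner J),
           span_edges {c} (inner J), span_edges ?R (inner J))"]) auto
  qed
qed

text \<open>The exponent \<open>42 * k * p\<close> is the cost of three codes. Halving \<open>p\<close> while doubling the
  number of subproblems keeps it from growing from one level to the next, and \<open>d\<close> counts the levels.\<close>

lemma card_slab_graphs_le:
  assumes V: "finite V" "card V = n" "2 \<le> n" "1 \<le> k" "k \<le> n" and "p < 2 ^ d"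
  shows "finite (slab_graphs V k p) \<and> card (slab_graphs V k p) \<le> n ^ (42 * k * p * d)"
  using \<open>p < 2 ^ d\<close>
proof (induction d arbitrary: p)
  case 0
  then have "slab_graphs V k p \<subseteq> {{}}" using slab_graphs_zero[of V k] by simp
  then show ?case using card_mono[of "{{}}" "slab_graphs V k p"] finite_subset[of _ "{{}}"] by auto
next
  case (Suc d)
  show ?case
  proof (cases "p = 0")
    case True
    then have "slab_graphs V k p \<subseteq> {{}}" using slab_graphs_zero[of V k] by simp
    then show ?thesis
      using True card_mono[of "{{}}" "slab_graphs V k p"] finite_subset[of _ "{{}}"] by auto
  next
    case False
    let ?q = "p div 2" and ?S = "slab_graphs V k (p div 2)" and ?C = "codes V k p"
    have IH: "finite ?S" "card ?S \<le> n ^ (42 * k * ?q * d)" using Suc by auto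
    note C = card_codes_le[OF V, of p]
    let ?P = "?S \<times> ?S \<times> ?C \<times> ?C \<times> ?C"
    have finP: "finite ?P" using IH C by simp
    have "slab_graphs V k p \<subseteq> (\<lambda>(A, B, C, D, E). A \<union> B \<union> C \<union> D \<union> E) ` ?P"
      using slab_graphs_split[of p V k] False by simp
    then have "finite (slab_graphs V k p)" "card (slab_graphs V k p) \<le> card ?P"
      using finP by (auto intro: finite_surj surj_card_le)
    moreover have "card ?P = card ?S * (card ?S * (card ?C * (card ?C * card ?C)))"
      by (simp only: card_cartesian_product)
    moreover have "\<dots> \<le> n ^ (42 * k * ?q * d) * (n ^ (42 * k * ?q * d) *
        (n ^ (14 * k * p) * (n ^ (14 * k * p) * n ^ (14 * k * p))))"
      using IH C by (intro mult_le_mono) auto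
    moreover have "\<dots> = n ^ (42 * k * (2 * ?q) * d + 42 * k * p)"
      unfolding power_add[symmetric] by (rule arg_cong[where f = "power n"]) simp
    moreover have "\<dots> \<le> n ^ (42 * k * p * d + 42 * k * p)"
      using V by (intro power_increasing add_mono mult_le_mono) auto
    ultimately show ?thesis by (simp add: algebra_simps)
  qed
qed

section \<open>The upper bound\<close>

lemma clique_number_le_iff:
  assumes "finite V"
  shows "clique_number V E \<le> k \<longleftrightarrow> (\<forall>K\<subseteq>V. clique K E \<longrightarrow> card K \<le> k)"
proof -
  have "{} \<in> {K. K \<subseteq> V \<and> clique K E}" by (simp add: clique_def)
  then have "card ` {K. K \<subseteq> V \<and> clique K E} \<noteq> {}" by blast
  moreover have "finite (card ` {K. K \<subseteq> V \<and> clique K E})" using assms by simp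
  ultimately show ?thesis unfolding clique_number_def by (subst Max_le_iff) auto
qed

text \<open>Over the slab \<open>UNIV\<close> every curve has both of its endpoints, so the whole graph consists of inner
  edges of a slab with \<open>2 * n\<close> endpoints.\<close>

lemma bounded_clique_graphs_are_slab_graphs:
  "{E \<in> xmono_pseudo_segment_graphs n. clique_number {1..n} E \<le> k} \<subseteq> slab_graphs {1..n} k (2 * n)"
proof
  fix E assume E: "E \<in> {E \<in> xmono_pseudo_segment_graphs n. clique_number {1..n} E \<le> k}"
  then obtain \<gamma> where g: "pseudo_segments {1..n} \<gamma>" "\<forall>i\<in>{1..n}. x_monotone (\<gamma> i)"
    and EE: "E = intersection_edges {1..n} \<gamma>" and cl: "clique_number {1..n} E \<le> k"
    by (auto simp: xmono_pseudo_segment_graphs_def)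
  have "\<exists>l r f. l \<le> r \<and> continuous_on {l..r} f \<and> \<gamma> i = (\<lambda>x. (x, f x)) ` {l..r}" if "i \<in> {1..n}" for i
    using g that x_monotone_curve_graph[of "\<gamma> i"] by (auto simp: pseudo_segments_def)
  then obtain l r f where lrf: "\<And>i. i \<in> {1..n} \<Longrightarrow> l i \<le> r i \<and> continuous_on {l i..r i} (f i) \<and>
      \<gamma> i = (\<lambda>x. (x, f i x)) ` {l i..r i}" by metis
  interpret curves "{1..n}" l r f by standard (use lrf in auto)
  have meets: "meets UNIV i j \<longleftrightarrow> \<gamma> i \<inter> \<gamma> j \<noteq> {}" if "i \<in> {1..n}" "j \<in> {1..n}" for i j
  proof -
    have gi: "\<gamma> i = (\<lambda>x. (x, f i x)) ` {l i..r i}" and gj: "\<gamma> j = (\<lambda>x. (x, f j x)) ` {l j..r j}"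
      using lrf that by auto
    have "meets UNIV i j \<longleftrightarrow> (\<exists>x. (x, f i x) \<in> \<gamma> i \<inter> \<gamma> j)"
      unfolding meets_def gi gj by (auto simp: image_iff)
    also have "\<dots> \<longleftrightarrow> \<gamma> i \<inter> \<gamma> j \<noteq> {}" unfolding gi by blast
    finally show ?thesis .
  qed
  interpret bounded_clique_curves "{1..n}" l r f k
  proof
    fix K assume K: "K \<subseteq> {1..n}" "\<forall>i\<in>K. \<forall>j\<in>K. i \<noteq> j \<longrightarrow> meets UNIV i j"
    have "clique K E" unfolding clique_def EE intersection_edges_def
    proof (intro ballI impI CollectI)
      fix i j assume ij: "i \<in> K" "j \<in> K" "i \<noteq> j"
      then have "i \<in> {1..n}" "j \<in> {1..n}" "meets UNIV i j" using K by auto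
      then show "\<exists>i' j'. {i, j} = {i', j'} \<and> i' \<in> {1..n} \<and> j' \<in> {1..n} \<and> i' \<noteq> j' \<and> \<gamma> i' \<inter> \<gamma> j' \<noteq> {}"
        using meets[of i j] ij by blast
    qed
    then show "card K \<le> k" using cl K clique_number_le_iff[of "{1..n}" E k] by simp
  qed
  have "inner UNIV = {1..n}" unfolding inner_def by auto
  then have "(i \<in> inner UNIV \<and> j \<in> inner UNIV \<and> i \<noteq> j \<and> meets UNIV i j) \<longleftrightarrow>
      (i \<in> {1..n} \<and> j \<in> {1..n} \<and> i \<noteq> j \<and> \<gamma> i \<inter> \<gamma> j \<noteq> {})" for i j
    using meets[of i j] by blast
  then have "inner_edges UNIV = E"
    unfolding inner_edges_def EE intersection_edges_def by presburger
  moreover have "ends UNIV = {1..n} <+> {1..n}" unfolding ends_def by simp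
  then have "card (ends UNIV) = 2 * n" by (simp add: card_Plus)
  ultimately show "E \<in> slab_graphs {1..n} k (2 * n)"
    unfolding slab_graphs_def using bounded_clique_curves_axioms by (intro CollectI exI[of _ l] exI[of _ r] exI[of _ f] exI[of _ UNIV]) auto
qed

lemma num_graphs_upper_small_clique:
  assumes "2 \<le> n" "1 \<le> k" "k \<le> n"
  shows "real (num_graphs n k) \<le> 2 powr (252 * (real k * real n * (log 2 (real n))\<^sup>2))"
proof -
  define L where "L = log 2 (real n)"
  have L: "1 \<le> L" using assms by (simp add: L_def)
  define d where "d = nat \<lfloor>L\<rfloor> + 2"
  have d: "L < real d - 1" "real d \<le> 3 * L" using L unfolding d_def by linarith+
  have n: "real n = 2 powr L" using assms by (simp add: L_def)
  have "real (2 * n) = 2 powr (1 + L)" by (simp add: n powr_add)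
  also have "\<dots> < 2 powr real d" using d by simp
  also have "\<dots> = real (2 ^ d)" by (simp add: powr_realpow)
  finally have "2 * n < 2 ^ d" by (simp only: of_nat_less_iff)
  then have S: "finite (slab_graphs {1..n} k (2 * n))"
    "card (slab_graphs {1..n} k (2 * n)) \<le> n ^ (42 * k * (2 * n) * d)"
    using card_slab_graphs_le[of "{1..n}" n k "2 * n" d] assms by auto
  have "num_graphs n k \<le> n ^ (42 * k * (2 * n) * d)"
    unfolding num_graphs_def
    using card_mono[OF S(1) bounded_clique_graphs_are_slab_graphs] S(2) by (rule le_trans)
  then have "real (num_graphs n k) \<le> real n ^ (42 * k * (2 * n) * d)"
    by (metis of_nat_le_iff of_nat_power)
  also have "\<dots> = 2 powr (L * real (42 * k * (2 * n) * d))"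
    unfolding powr_powr[symmetric] n[symmetric] using assms by (subst powr_realpow) auto
  also have "\<dots> \<le> 2 powr (252 * (real k * real n * L\<^sup>2))"
  proof -
    have "84 * real k * real n * L * real d \<le> 84 * real k * real n * L * (3 * L)"
      using d L by (intro mult_left_mono) auto
    then show ?thesis by (simp add: power2_eq_square algebra_simps)
  qed
  finally show ?thesis by (simp add: L_def)
qed

text \<open>A bound on the clique number above \<open>n\<close> is no stronger than the bound \<open>n\<close>, so \<open>k\<close> can be
  replaced by \<open>min k n\<close>.\<close>

lemma num_graphs_upper:
  assumes "1 \<le> k" "1 \<le> n"
  shows "real (num_graphs n k) \<le> 2 powr (252 * (real k * real n * (log 2 (real n))\<^sup>2))"
proof (cases "n = 1")
  case True
  have "{E \<in> xmono_pseudo_segment_graphs 1. clique_number {1..1} E \<le> k} \<subseteq> {{}}"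
    by (auto simp: xmono_pseudo_segment_graphs_def intersection_edges_def)
  then have "num_graphs 1 k \<le> card {{} :: nat set set}"
    unfolding num_graphs_def by (intro card_mono) auto
  then show ?thesis using True by simp
next
  case False
  define k' where "k' = min k n"
  have "card K \<le> n" if "K \<subseteq> {1..n}" for K using card_mono[OF _ that] by simp
  then have "clique_number {1..n} E \<le> n" for E by (simp add: clique_number_le_iff)
  then have "num_graphs n k = num_graphs n k'"
    unfolding num_graphs_def k'_def by simp
  also have "real \<dots> \<le> 2 powr (252 * (real k' * real n * (log 2 (real n))\<^sup>2))"
    using assms False by (intro num_graphs_upper_small_clique) (auto simp: k'_def)
  also have "\<dots> \<le> 2 powr (252 * (real k * real n * (log 2 (real n))\<^sup>2))"
    by (intro powr_mono mult_left_mono mult_right_mono) (auto simp: k'_def)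
  finally show ?thesis .
qed
section \<open>Perturbed lines\<close>

abbreviation graph_over :: "(real \<Rightarrow> real) \<Rightarrow> real set \<Rightarrow> (real \<times> real) set" where
  "graph_over g A \<equiv> (\<lambda>x. (x, g x)) ` A"

lemma graph_over_is_curve:
  assumes "u < v" "continuous_on {u..v} g"
  shows "is_curve (graph_over g {u..v})"
proof -
  have "{u..v} homeomorphic graph_over g {u..v}"
    using assms by (intro homeomorphic_compact[where f = "\<lambda>x. (x, g x)"])
      (auto intro!: continuous_intros inj_onI)
  moreover have "{u..v} homeomorphic {0..1::real}"
    using assms by (intro homeomorphic_closed_intervals_real) auto
  ultimately show ?thesis unfolding is_curve_def using homeomorphic_sym homeomorphic_trans by blast
qed

lemma graph_over_x_monotone: "x_monotone (graph_over g A)"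
  unfolding x_monotone_def by (auto simp: Uniq_def vertical_line_def)

text \<open>The lifting of the line \<open>y = m x + c\<close> vanishes at the abscissae \<open>t\<close> with \<open>(m, c, t) \<in> T\<close> and equals
  \<open>1 / 4\<close> at all other positive integers. The factor \<open>1 / 4\<close> makes its Lipschitz constant small
  against the differences of slopes, which are at least \<open>1\<close>, and its size small against the
  differences of intercepts. The abscissa \<open>0\<close>, which carries no point, is
  inserted because \<open>infdist x {} = 0\<close>.\<close>

definition wiggle :: "(nat \<times> nat \<times> nat) set \<Rightarrow> nat \<Rightarrow> nat \<Rightarrow> real \<Rightarrow> real" where
  "wiggle T m c x = min 1 (infdist x (insert 0 (real ` {t. (m, c, t) \<in> T}))) / 4"

definition line :: "(nat \<times> nat \<times> nat) set \<Rightarrow> nat \<Rightarrow> nat \<Rightarrow> real \<Rightarrow> real" where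
  "line T m c x = real m * x + real c + wiggle T m c x"

lemma wiggle_bounds: "0 \<le> wiggle T m c x" "wiggle T m c x \<le> 1 / 4"
  by (auto simp: wiggle_def infdist_nonneg)

lemma wiggle_lipschitz: "\<bar>wiggle T m c x - wiggle T m c y\<bar> \<le> \<bar>x - y\<bar> / 4"
proof -
  have "\<bar>min 1 p / 4 - min 1 q / 4\<bar> \<le> \<bar>p - q\<bar> / 4" for p q :: real
    by (auto simp: min_def abs_if)
  then show ?thesis
    using infdist_triangle_abs[of x "insert 0 (real ` {t. (m, c, t) \<in> T})" y]
    unfolding wiggle_def dist_real_def by (meson divide_right_mono order_trans zero_le_numeral)
qed

lemma wiggle_step:
  assumes "x < y"
  shows "wiggle T m c x - (y - x) / 4 \<le> wiggle T m c y" "wiggle T m c y \<le> wiggle T m c x + (y - x) / 4"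
proof -
  have "\<bar>wiggle T m c x - wiggle T m c y\<bar> \<le> (y - x) / 4"
    using wiggle_lipschitz[of T m c x y] assms by simp
  then show "wiggle T m c x - (y - x) / 4 \<le> wiggle T m c y"
    "wiggle T m c y \<le> wiggle T m c x + (y - x) / 4" by (simp_all only: abs_le_iff) linarith+
qed

lemma continuous_line: "continuous_on A (line T m c)"
  unfolding line_def wiggle_def by (intro continuous_intros) auto

lemma wiggle_at_nat:
  assumes "1 \<le> x"
  shows "wiggle T m c (real x) = (if (m, c, x) \<in> T then 0 else 1 / 4)"
proof (cases "(m, c, x) \<in> T")
  case True
  then show ?thesis by (simp add: wiggle_def infdist_zero)
next
  case False
  let ?A = "insert 0 (real ` {t. (m, c, t) \<in> T})"
  have "1 \<le> dist (real x) z" if z: "z \<in> ?A" for z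
  proof -
    obtain t where t: "z = real t" "t \<noteq> x" using z False assms by auto
    then have "1 \<le> \<bar>int x - int t\<bar>" by auto
    then have "1 \<le> real_of_int \<bar>int x - int t\<bar>" by linarith
    then show ?thesis by (simp add: t dist_real_def)
  qed
  then have "1 \<le> infdist (real x) ?A" 
    by (subst infdist_notempty) (blast, rule cINF_greatest, blast+)
  then show ?thesis using False by (simp add: wiggle_def)
qed

text \<open>The slope of the difference is at least \<open>1\<close>, and the two liftings change it by at most
  \<open>1 / 4\<close> each.\<close>

lemma lines_cross_once:
  assumes "m < m'" "x < y"
  shows "line T m' c' x - line T m c x < line T m' c' y - line T m c y"
proof -
  have "1 * (y - x) \<le> (real m' - real m) * (y - x)" using assms by (intro mult_right_mono) auto
  then have "y - x \<le> real m' * y - real m * y - (real m' * x - real m * x)"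
    by (simp add: algebra_simps)
  then show ?thesis
    using wiggle_step(2)[OF assms(2), of T m c] wiggle_step(1)[OF assms(2), of T m' c'] assms(2)
    unfolding line_def by argo
qed

lemma parallel_lines_disjoint:
  assumes "c \<noteq> c'"
  shows "line T m c x \<noteq> line T m c' x"
proof -
  have "1 \<le> \<bar>real c - real c'\<bar>" using assms by linarith
  then show ?thesis using wiggle_bounds[of T m c x] wiggle_bounds[of T m c' x]
    unfolding line_def by linarith
qed

lemma line_increasing:
  assumes "1 \<le> m" "x < y"
  shows "line T m c x < line T m c y"
proof -
  have "1 * (y - x) \<le> real m * (y - x)" using assms by (intro mult_right_mono) auto
  then have "y - x \<le> real m * y - real m * x" by (simp add: algebra_simps)
  then show ?thesis using wiggle_step(1)[OF assms(2), of T m c] assms(2)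
    unfolding line_def by argo
qed

section \<open>Incidence graphs of a grid\<close>

text \<open>The set \<open>P\<close> of points may be larger than the set of points on the lines: points on no line are
  isolated vertices, which serve to reach a prescribed number of vertices.\<close>

locale grid =
  fixes s h a :: nat and P :: "(nat \<times> nat) set"
  assumes P_fst: "(x, y) \<in> P \<Longrightarrow> x \<in> {1..a}"
    and finite_P: "finite P"
    and P_grid: "m \<in> {1..s} \<Longrightarrow> c \<in> {1..h} \<Longrightarrow> x \<in> {1..a} \<Longrightarrow> (x, m * x + c) \<in> P"
begin

text \<open>Perturbed lines have slope at most \<open>s + 1 / 4\<close>, so over this distance they rise by less than
  \<open>1 / 4\<close>, too little to pass from the lifted height to the height of the point.\<close>

definition radius :: real where "radius = 1 / (8 * (real s + 1))"

fun curve :: "(nat \<times> nat \<times> nat) set \<Rightarrow> (nat \<times> nat) + (nat \<times> nat) \<Rightarrow> (real \<times> real) set" where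
  "curve T (Inl (m, c)) = graph_over (line T m c) {0..real a + 1}"
| "curve T (Inr (x, y)) = graph_over (\<lambda>_. real y) {real x - radius..real x + radius}"

definition vertices :: "((nat \<times> nat) + (nat \<times> nat)) set" where
  "vertices = ({1..s} \<times> {1..h}) <+> P"

lemma radius: "0 < radius" "radius \<le> 1 / 8"
  by (auto simp: radius_def field_simps)

lemma line_near_point:
  assumes "m \<le> s" "\<bar>t - x\<bar> \<le> radius"
  shows "\<bar>line T m c t - line T m c x\<bar> < 1 / 4"
proof -
  have "\<bar>real m * (t - x)\<bar> \<le> real s * radius"
    unfolding abs_mult using assms by (intro mult_mono) auto
  moreover have "(real s + 1) * radius = 1 / 8" by (simp add: radius_def)
  then have "real s * radius \<le> 1 / 8" using radius by (simp add: algebra_simps)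
  ultimately show ?thesis using wiggle_lipschitz[of T m c t x] assms(2) radius
    unfolding line_def by (simp add: algebra_simps abs_if split: if_splits)
qed

text \<open>The line passes within \<open>1 / 4\<close> of the height \<open>y\<close> at the abscissa \<open>x\<close> if it meets the segment
  at all. Its height there is the integer \<open>m * x + c\<close> plus a lifting of \<open>0\<close> or \<open>1 / 4\<close>, so
  \<open>y = m * x + c\<close> and the lifting is \<open>0\<close>.\<close>

lemma line_meets_point_iff:
  assumes "m \<in> {1..s}" "x \<in> {1..a}"
  shows "curve T (Inl (m, c)) \<inter> curve T (Inr (x, y)) \<noteq> {} \<longleftrightarrow> y = m * x + c \<and> (m, c, x) \<in> T"
proof
  assume "curve T (Inl (m, c)) \<inter> curve T (Inr (x, y)) \<noteq> {}"
  then obtain t where "real x - radius \<le> t" "t \<le> real x + radius" and t: "line T m c t = real y"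
    by auto
  then have "\<bar>t - real x\<bar> \<le> radius" by linarith
  have near: "\<bar>real y - (real (m * x + c) + wiggle T m c x)\<bar> < 1 / 4"
    using line_near_point[of m t "real x" T c] t \<open>\<bar>t - real x\<bar> \<le> radius\<close> assms(1)
    by (simp add: line_def[of T m c "real x"])
  moreover have "1 \<le> \<bar>real y - real (m * x + c)\<bar>" if "y \<noteq> m * x + c" using that by linarith
  ultimately have "y = m * x + c" using wiggle_bounds[of T m c "real x"] by linarith
  then show "y = m * x + c \<and> (m, c, x) \<in> T"
    using near wiggle_at_nat[of x T m c] assms by (auto split: if_splits)
next
  assume *: "y = m * x + c \<and> (m, c, x) \<in> T"
  then have "line T m c (real x) = real y"
    using wiggle_at_nat[of x T m c] assms by (simp add: line_def)
  then have "(real x, real y) \<in> curve T (Inl (m, c))" using assms by (auto intro!: image_eqI[of _ _ "real x"])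
  moreover have "(real x, real y) \<in> curve T (Inr (x, y))" using radius by (auto intro!: image_eqI[of _ _ "real x"])
  ultimately show "curve T (Inl (m, c)) \<inter> curve T (Inr (x, y)) \<noteq> {}" by blast
qed

lemma points_disjoint:
  assumes "(x, y) \<noteq> (x', y')"
  shows "curve T (Inr (x, y)) \<inter> curve T (Inr (x', y')) = {}"
proof (rule ccontr)
  assume "\<not> ?thesis"
  then obtain t where t: "y = y'" "real x - radius \<le> t" "t \<le> real x + radius"
    "real x' - radius \<le> t" "t \<le> real x' + radius" by auto
  then have "\<bar>real x - real x'\<bar> < 1" using radius by linarith
  then show False using assms t by simp
qed

lemma parallel_curves_disjoint:
  "c \<noteq> c' \<Longrightarrow> curve T (Inl (m, c)) \<inter> curve T (Inl (m, c')) = {}"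
  using parallel_lines_disjoint by auto

lemma graph_over_Uniq:
  assumes "\<And>x y. x < y \<Longrightarrow> g x = g' x \<Longrightarrow> g y \<noteq> g' y"
  shows "\<exists>\<^sub>\<le>\<^sub>1 p. p \<in> graph_over g A \<inter> graph_over g' B"
proof (rule Uniq_I)
  fix p q assume pq: "p \<in> graph_over g A \<inter> graph_over g' B" "q \<in> graph_over g A \<inter> graph_over g' B"
  then have eq: "g (fst p) = g' (fst p)" "g (fst q) = g' (fst q)" by auto
  have "fst p = fst q"
    using assms[of "fst p" "fst q"] assms[of "fst q" "fst p"] eq by (meson linorder_neqE)
  then show "p = q" using pq by auto
qed

lemma curves_meet_once:
  assumes "v \<in> vertices" "w \<in> vertices" "v \<noteq> w"
  shows "\<exists>\<^sub>\<le>\<^sub>1 p. p \<in> curve T v \<inter> curve T w"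
proof -
  have lp: "\<exists>\<^sub>\<le>\<^sub>1 p. p \<in> curve T (Inl (m, c)) \<inter> curve T (Inr (x, y))" if "1 \<le> m" for m c x y
    unfolding curve.simps using line_increasing[OF that] by (intro graph_over_Uniq) (metis less_irrefl)
  have ll: "\<exists>\<^sub>\<le>\<^sub>1 p. p \<in> curve T (Inl (m, c)) \<inter> curve T (Inl (m', c'))" if "m < m'" for m c m' c'
    unfolding curve.simps using lines_cross_once[OF that]
    by (intro graph_over_Uniq) (metis diff_self less_irrefl)
  consider m c m' c' where "v = Inl (m, c)" "w = Inl (m', c')" "m < m' \<or> m' < m"
    | m c c' where "v = Inl (m, c)" "w = Inl (m, c')" "c \<noteq> c'"
    | m c x y where "v = Inl (m, c)" "w = Inr (x, y)" "1 \<le> m"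
    | m c x y where "w = Inl (m, c)" "v = Inr (x, y)" "1 \<le> m"
    | x y x' y' where "v = Inr (x, y)" "w = Inr (x', y')" "(x, y) \<noteq> (x', y')"
    using assms unfolding vertices_def by (auto elim!: PlusE) (metis linorder_neqE_nat)+
  then show ?thesis
  proof cases
    case 1
    then show ?thesis using ll[of m m' c c'] ll[of m' m c' c] by (auto simp: Int_commute)
  next
    case 2
    then show ?thesis using parallel_curves_disjoint by (simp add: Uniq_def)
  next
    case 3
    then show ?thesis using lp by simp
  next
    case 4
    then show ?thesis using lp[of m c x y] by (simp add: Int_commute)
  next
    case 5
    then show ?thesis using points_disjoint by (simp add: Uniq_def)
  qed
qed

lemma curve_is_curve: "is_curve (curve T v)"
  using radius by (cases "(T, v)" rule: curve.cases) (auto intro!: graph_over_is_curve continuous_line)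

lemma curve_x_monotone: "x_monotone (curve T v)"
  by (cases "(T, v)" rule: curve.cases) (auto intro!: graph_over_x_monotone)

text \<open>Lines of equal slope are disjoint, and so are points. Sending a line to its slope and a point to
  \<open>0\<close>, which is not a slope, is therefore injective on a clique.\<close>

lemma clique_card_le:
  assumes K: "K \<subseteq> vertices" and meet: "\<And>v w. v \<in> K \<Longrightarrow> w \<in> K \<Longrightarrow> v \<noteq> w \<Longrightarrow> curve T v \<inter> curve T w \<noteq> {}"
  shows "card K \<le> s + 1"
proof -
  let ?slope = "case_sum fst (\<lambda>_. 0)"
  have "inj_on ?slope K"
  proof (rule inj_onI, rule ccontr)
    fix v w assume vw: "v \<in> K" "w \<in> K" "?slope v = ?slope w" "v \<noteq> w"
    have v_vertices: "v \<in> vertices" and w_vertices: "w \<in> vertices" using vw(1,2) K by blast+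
    have "curve T v \<inter> curve T w = {}"
    proof (cases v)
      case (Inl p)
      obtain m c where p: "p = (m, c)" by (cases p)
      have "1 \<le> m" using v_vertices by (auto simp: vertices_def Inl p)
      then obtain q where w: "w = Inl q" using w_vertices vw(3) by (cases w) (auto simp: Inl p)
      obtain c' where q: "q = (m, c')" using vw(3) by (cases q) (simp add: Inl p w)
      show ?thesis using vw(4) parallel_curves_disjoint[of c c' T m] by (simp only: Inl p w q) blast
    next
      case (Inr p)
      obtain q where w: "w = Inr q" using w_vertices vw(3) by (cases w) (auto simp: Inr vertices_def)
      obtain x y x' y' where "p = (x, y)" "q = (x', y')" by (cases p; cases q)
      then show ?thesis using vw(4) points_disjoint[of x y x' y' T] by (simp only: Inr w) blast
    qed
    then show False using meet[OF vw(1,2,4)] by contradiction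
  qed
  then have "card K = card (?slope ` K)" by (simp add: card_image)
  also have "\<dots> \<le> card {0..s}" using K by (intro card_mono) (auto simp: vertices_def)
  finally show ?thesis by simp
qed

lemma card_vertices: "card vertices = s * h + card P"
  using finite_P by (simp add: vertices_def card_Plus)

text \<open>The set \<open>T\<close> of kept incidences can be read off from the edges between lines and grid points.\<close>

lemma num_graphs_lower:
  assumes n: "card vertices = n" and k: "s + 1 \<le> k"
  shows "2 ^ (s * h * a) \<le> num_graphs n k"
proof -
  have "finite vertices" using finite_P by (simp add: vertices_def)
  then obtain b where b: "bij_betw b {1..n} vertices"
    using ex_bij_betw_nat_finite_1[of vertices] n by auto
  have b_vertices: "b i \<in> vertices" if "i \<in> {1..n}" for i using bij_betw_apply[OF b that] .
  have b_eq: "b i = b j \<longleftrightarrow> i = j" if "i \<in> {1..n}" "j \<in> {1..n}" for i j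
    using inj_on_eq_iff[OF bij_betw_imp_inj_on[OF b] that] .
  define B where "B = inv_into {1..n} b"
  have B: "B v \<in> {1..n}" "b (B v) = v" if "v \<in> vertices" for v
    unfolding B_def using bij_betw_inv_into_right[OF b that]
      bij_betw_apply[OF bij_betw_inv_into[OF b] that] by auto
  define G where "G = (\<lambda>T. intersection_edges {1..n} (\<lambda>i. curve T (b i)))"
  have edge: "{i, j} \<in> G T \<longleftrightarrow> i \<noteq> j \<and> curve T (b i) \<inter> curve T (b j) \<noteq> {}"
    if "i \<in> {1..n}" "j \<in> {1..n}" for i j T
    unfolding G_def intersection_edges_def using that by (auto simp: doubleton_eq_iff Int_commute)
  let ?I = "{1..s} \<times> {1..h} \<times> {1..a}"
  have recover: "T = {(m, c, x) \<in> ?I. {B (Inl (m, c)), B (Inr (x, m * x + c))} \<in> G T}"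
    if T: "T \<subseteq> ?I" for T
  proof -
    have "(m, c, x) \<in> T \<longleftrightarrow> {B (Inl (m, c)), B (Inr (x, m * x + c))} \<in> G T"
      if "m \<in> {1..s}" "c \<in> {1..h}" "x \<in> {1..a}" for m c x
    proof -
      have v: "Inl (m, c) \<in> vertices" and w: "Inr (x, m * x + c) \<in> vertices"
        using that P_grid by (auto simp: vertices_def)
      have "B (Inl (m, c)) \<noteq> B (Inr (x, m * x + c))" using B(2)[OF v] B(2)[OF w] by auto
      then show ?thesis
        using edge[OF B(1)[OF v] B(1)[OF w]] line_meets_point_iff[OF that(1,3), of T c "m * x + c"]
        by (simp add: B(2)[OF v] B(2)[OF w])
    qed
    then show ?thesis using T by blast
  qed
  have "inj_on G (Pow ?I)"
  proof (rule inj_onI)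
    fix T T' assume TT: "T \<in> Pow ?I" "T' \<in> Pow ?I" "G T = G T'"
    have "T = {(m, c, x) \<in> ?I. {B (Inl (m, c)), B (Inr (x, m * x + c))} \<in> G T}"
      using TT by (intro recover) auto
    also have "\<dots> = {(m, c, x) \<in> ?I. {B (Inl (m, c)), B (Inr (x, m * x + c))} \<in> G T'}"
      by (simp only: TT(3))
    also have "\<dots> = T'" using TT by (intro recover[symmetric]) auto
    finally show "T = T'" .
  qed
  then have "2 ^ (s * h * a) = card (G ` Pow ?I)"
    by (simp add: card_image card_Pow card_cartesian_product)
  also have "\<dots> \<le> num_graphs n k"
    unfolding num_graphs_def
  proof (rule card_mono)
    show "G ` Pow ?I \<subseteq> {E \<in> xmono_pseudo_segment_graphs n. clique_number {1..n} E \<le> k}"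
    proof
      fix E assume "E \<in> G ` Pow ?I"
      then obtain T where E: "E = G T" by auto
      have "pseudo_segments {1..n} (\<lambda>i. curve T (b i))"
        unfolding pseudo_segments_def
        using curve_is_curve curves_meet_once b_vertices b_eq by simp
      then have "E \<in> xmono_pseudo_segment_graphs n"
        unfolding xmono_pseudo_segment_graphs_def E G_def using curve_x_monotone by blast
      moreover have "card K \<le> k" if K: "K \<subseteq> {1..n}" "clique K E" for K
      proof -
        have "inj_on b K" using inj_on_subset[OF bij_betw_imp_inj_on[OF b] K(1)] .
        then have "card K = card (b ` K)" by (simp add: card_image)
        also have "\<dots> \<le> s + 1"
        proof (rule clique_card_le)
          show "b ` K \<subseteq> vertices" using b_vertices K by auto
          fix v w assume "v \<in> b ` K" "w \<in> b ` K" "v \<noteq> w"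
          then obtain i j where ij: "v = b i" "w = b j" "i \<in> K" "j \<in> K" "i \<noteq> j" by auto
          then have adjacent: "{i, j} \<in> G T" using K unfolding clique_def E by blast
          have "i \<in> {1..n}" "j \<in> {1..n}" using ij(3,4) K(1) by blast+
          from iffD1[OF edge[OF this] adjacent] show "curve T v \<inter> curve T w \<noteq> {}"
            unfolding ij(1,2) by (rule conjunct2)
        qed
        finally show ?thesis using k by simp
      qed
      ultimately show "E \<in> {E \<in> xmono_pseudo_segment_graphs n. clique_number {1..n} E \<le> k}"
        by (simp add: clique_number_le_iff)
    qed
  qed (simp add: finite_xmono_pseudo_segment_graphs)
  finally show ?thesis .
qed

end

section \<open>The lower bound\<close>

lemma num_graphs_lower_params:
  assumes "1 \<le> a" "s * h + a * (s * a + h) \<le> n" "s + 1 \<le> k"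
  shows "2 ^ (s * h * a) \<le> num_graphs n k"
proof -
  let ?A = "{1..a} \<times> {1..s * a + h}" and ?C = "{1..a} \<times> {1..s * a + h + n}"
  have "n \<le> a * (s * a + h + n)" using assms(1) by (cases a) auto
  then have "\<exists>P. ?A \<subseteq> P \<and> P \<subseteq> ?C \<and> card P = n - s * h"
    using assms(2) by (intro exists_subset_between) (auto simp: card_cartesian_product)
  then obtain P where P: "?A \<subseteq> P" "P \<subseteq> ?C" "card P = n - s * h" by blast
  interpret grid s h a P
  proof
    show "finite P" using P(2) by (rule finite_subset) simp
    fix m c x assume "m \<in> {1..s}" "c \<in> {1..h}" "x \<in> {1..a}"
    then have "m * x + c \<le> s * a + h" by (intro add_mono mult_le_mono) auto
    then show "(x, m * x + c) \<in> P" using P(1) \<open>c \<in> {1..h}\<close> \<open>x \<in> {1..a}\<close> by auto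
  qed (use P in auto)
  show ?thesis using num_graphs_lower[OF _ assms(3)] card_vertices P(3) assms(2) by simp
qed

text \<open>With \<open>k - 1\<close> slopes, about \<open>n / (4 * k)\<close> intercepts and about \<open>k / 2\<close> abscissae, the lines number at
  most \<open>n / 4\<close> and the points at most \<open>k ^ 3 / 4 + n / 8\<close>; the hypothesis on \<open>k\<close> absorbs the
  cubic term.\<close>

lemma num_graphs_lower_cube:
  assumes "2 \<le> k" "k ^ 3 < n"
  shows "2 powr (real k * real n / 48) \<le> real (num_graphs n k)"
proof -
  define s h a where "s = k - 1" and "h = n div (4 * k)" and "a = k div 2"
  have k3: "k * (k * k) < n" using assms by (simp add: power3_eq_cube mult.assoc)
  have "4 * k \<le> k * (k * k)" using mult_le_mono[OF assms(1) assms(1)] by (simp add: mult.commute)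
  then have "4 * k < n" using k3 by linarith
  have h: "h * (4 * k) \<le> n" "n < (h + 1) * (4 * k)" 
    using assms div_mult_mod_eq[of n "4 * k"] mod_less_divisor[of "4 * k" n] unfolding h_def
    by (simp, simp only: distrib_right) linarith
  have "1 \<le> h" unfolding h_def using \<open>4 * k < n\<close> assms by (simp add: div_greater_zero_iff Suc_le_eq)
  have a: "2 * a \<le> k" "k \<le> 3 * a" "1 \<le> a" using assms by (auto simp: a_def)
  have "4 * (s * h) \<le> n" using h(1) mult_le_mono1[of s k "4 * h"] by (simp add: s_def algebra_simps)
  moreover have "4 * (a * (s * a)) \<le> k * (k * k)"
    using mult_le_mono[OF a(1) mult_le_mono[OF _ a(1)], of s k] by (simp add: s_def algebra_simps)
  moreover have "8 * (a * h) \<le> n"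
  proof -
    have "8 * (a * h) = 2 * a * (4 * h)" by simp
    also have "\<dots> \<le> k * (4 * h)" using a(1) by (rule mult_le_mono1)
    also have "\<dots> \<le> n" using h(1) by (simp add: mult.commute mult.left_commute)
    finally show ?thesis .
  qed
  ultimately have "s * h + a * (s * a + h) \<le> n" using k3 by (simp add: distrib_left)
  then have low: "2 ^ (s * h * a) \<le> num_graphs n k"
    using a assms by (intro num_graphs_lower_params) (auto simp: s_def)
  have s: "k \<le> 2 * s" using assms by (simp add: s_def)
  have "4 * k \<le> h * (4 * k)" using \<open>1 \<le> h\<close> by simp
  with h(2) have "n \<le> 2 * (h * (4 * k))" unfolding distrib_right by linarith
  then have "n \<le> 8 * k * h" by (simp add: algebra_simps)
  then have "k * n \<le> k * (8 * k * h)" by simp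
  also have "\<dots> = 8 * (k * k * h)" by simp
  also have "\<dots> \<le> 8 * ((2 * s) * (3 * a) * h)" using s a by (intro mult_le_mono) auto
  finally have "k * n \<le> 48 * (s * h * a)" by (simp add: algebra_simps)
  then have "real k * real n \<le> 48 * real (s * h * a)"
    by (metis of_nat_le_iff of_nat_mult of_nat_numeral)
  then have "2 powr (real k * real n / 48) \<le> 2 powr real (s * h * a)" by simp
  also have "\<dots> = real (2 ^ (s * h * a))" by (subst powr_realpow) auto
  also have "\<dots> \<le> real (num_graphs n k)" using low by (simp only: of_nat_le_iff)
  finally show ?thesis .
qed

section \<open>Both bounds together\<close>

theorem theorem1p3:
  shows "(\<exists>C::real. C > 0 \<and>
            (\<forall>k n :: nat. k \<ge> 1 \<and> n \<ge> 1 \<longrightarrow>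
               real (num_graphs n k) \<le> 2 powr (C * (real k * real n * (log 2 (real n))\<^sup>2)))) \<and>
         (\<exists>C::real. \<exists>d::nat. C > 0 \<and>
            (\<forall>k n :: nat. k \<ge> 2 \<and> n \<ge> 1 \<and> real k < real n powr (1/3) \<longrightarrow>
               real (num_graphs n k) \<ge>
                 2 powr (real k * real n * (log 2 (real n))\<^sup>2 / (C * (log 2 (real n)) ^ d))))"
proof (intro conjI)
  show "\<exists>C::real. C > 0 \<and> (\<forall>k n :: nat. k \<ge> 1 \<and> n \<ge> 1 \<longrightarrow>
      real (num_graphs n k) \<le> 2 powr (C * (real k * real n * (log 2 (real n))\<^sup>2)))"
    using num_graphs_upper by (intro exI[of _ 252]) auto
  have "2 powr (real k * real n * (log 2 (real n))\<^sup>2 / (48 * (log 2 (real n)) ^ 2)) \<le> real (num_graphs n k)"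
    if "k \<ge> 2 \<and> n \<ge> 1 \<and> real k < real n powr (1/3)" for k n :: nat
  proof -
    have "real k ^ 3 < (real n powr (1/3)) ^ 3" using that by (intro power_strict_mono) auto
    also have "\<dots> = real n" using that by (simp add: powr_powr flip: powr_realpow)
    finally have k3: "k ^ 3 < n" by (metis of_nat_less_iff of_nat_power)
    have "1 \<le> k ^ 3" using that by simp
    then have "1 < n" using k3 by linarith
    then have "0 < log 2 (real n)" by (subst zero_less_log_cancel_iff) auto
    then have cancel: "real k * real n * (log 2 (real n))\<^sup>2 / (48 * (log 2 (real n))\<^sup>2) = real k * real n / 48"
      by (simp add: field_simps)
    show ?thesis unfolding cancel using num_graphs_lower_cube[of k n] k3 that by blast
  qed
  then show "\<exists>C::real. \<exists>d::nat. C > 0 \<and>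
      (\<forall>k n :: nat. k \<ge> 2 \<and> n \<ge> 1 \<and> real k < real n powr (1/3) \<longrightarrow>
         real (num_graphs n k) \<ge>
           2 powr (real k * real n * (log 2 (real n))\<^sup>2 / (C * (log 2 (real n)) ^ d)))"
    by (intro exI[of _ 48] exI[of _ 2]) auto
qed

end
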